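(* The semigroup $\mathbf{I}\mathbb{N}_{\infty}$ of all partial cofinite isometries of $\mathbb{N}$ is simple.
   Context: $\mathbb{N}=\{1,2,3,\ldots\}$ with the metric $d(n,m)=|n-m|$. $\mathbf{I}\mathbb{N}_{\infty}$ is the set of all partial maps $\alpha:\mathbb{N}\rightharpoonup\mathbb{N}$ such that $\mathbb{N}\setminus\operatorname{dom}\alpha$ and $\mathbb{N}\setminus\operatorname{ran}\alpha$ are finite and $|(x)\alpha-(y)\alpha|=|x-y|$ for all $x,y\in\operatorname{dom}\alpha$. It is an inverse monoid under composition of partial maps, written left to right: $(x)(\alpha\beta)=((x)\alpha)\beta$, with $\operatorname{dom}(\alpha\beta)=\{x\in\operatorname{dom}\alpha:(x)\alpha\in\operatorname{dom}\beta\}$. A semigroup $S$ is simple if it contains no proper two-sided ideals, i.e. $S$ consists of a single $\mathscr{J}$-class. *)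

theory Defs
  imports "HOL-Algebra.Group"
begin

locale semigroup_on =
  fixes S (structure)
  assumes mult_closed: "\<lbrakk>x \<in> carrier S; y \<in> carrier S\<rbrakk> \<Longrightarrow> x \<otimes> y \<in> carrier S"
    and mult_assoc: "\<lbrakk>x \<in> carrier S; y \<in> carrier S; z \<in> carrier S\<rbrakk>
      \<Longrightarrow> (x \<otimes> y) \<otimes> z = x \<otimes> (y \<otimes> z)"

text \<open>As usual in semigroup theory, the empty set does not count as an ideal.\<close>

definition two_sided_ideal :: "'a set \<Rightarrow> ('a, 'm) monoid_scheme \<Rightarrow> bool" where
  "two_sided_ideal I S \<longleftrightarrow>
     I \<subseteq> carrier S \<and> I \<noteq> {} \<and>
     (\<forall>a\<in>I. \<forall>s\<in>carrier S. s \<otimes>\<^bsub>S\<^esub> a \<in> I \<and> a \<otimes>\<^bsub>S\<^esub> s \<in> I)"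

locale simple_semigroup = semigroup_on +
  assumes no_proper_ideal: "two_sided_ideal I S \<Longrightarrow> I = carrier S"

text \<open>
  The underlying set is \<open>{1, 2, 3, \<dots>}\<close>; a partial self-map of it is a map of type
  \<open>nat \<rightharpoonup> nat\<close> whose domain and range avoid \<open>0\<close>.
\<close>

abbreviation pos_nats :: "nat set" where
  "pos_nats \<equiv> {1..}"

definition partial_cofinite_isometries :: "(nat \<rightharpoonup> nat) set" where
  "partial_cofinite_isometries =
     {\<alpha>. dom \<alpha> \<subseteq> pos_nats \<and> ran \<alpha> \<subseteq> pos_nats \<and>
          finite (pos_nats - dom \<alpha>) \<and> finite (pos_nats - ran \<alpha>) \<and>
          (\<forall>x\<in>dom \<alpha>. \<forall>y\<in>dom \<alpha>.
             \<bar>int (the (\<alpha> x)) - int (the (\<alpha> y))\<bar> = \<bar>int x - int y\<bar>)}"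

text \<open>
  Maps compose from left to right, so the product of \<open>\<alpha>\<close> and \<open>\<beta>\<close> applies \<open>\<alpha>\<close> first.
\<close>

definition IN_infinity :: "(nat \<rightharpoonup> nat) monoid" where
  "IN_infinity =
     \<lparr>carrier = partial_cofinite_isometries,
      mult = (\<lambda>\<alpha> \<beta>. \<beta> \<circ>\<^sub>m \<alpha>),
      one = Some |` pos_nats\<rparr>"

end

theory Submission
  imports Defs
begin

text \<open>
  A cofinite partial isometry of \<open>{1, 2, 3, \<dots>}\<close> is a restricted translation: a reflection would
  send large arguments below \<open>1\<close> (\<open>isometry_is_translation\<close>).  As its domain is cofinite, an
  element \<open>\<alpha>\<close> is therefore an honest translation beyond some point.  Shifting upwards
  first, past all gaps of the domain, makes \<open>\<alpha>\<close> into a total upward shift, which is undone by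
  the downward shift of the same length.  So every \<open>\<alpha>\<close> satisfies \<open>\<beta> \<alpha> \<gamma> = 1\<close> for suitable
  \<open>\<beta>\<close> and \<open>\<gamma>\<close> in the monoid (\<open>two_sided_divisor_of_one\<close>); hence every two-sided
  ideal contains the identity and is everything.  The two kinds of shifts used here generate a
  copy of the bicyclic monoid.
\<close>

lemma partial_cofinite_isometriesI:
  assumes "dom \<alpha> \<subseteq> pos_nats" "ran \<alpha> \<subseteq> pos_nats"
    "finite (pos_nats - dom \<alpha>)" "finite (pos_nats - ran \<alpha>)"
    "\<And>x y u v. \<alpha> x = Some u \<Longrightarrow> \<alpha> y = Some v \<Longrightarrow> \<bar>int u - int v\<bar> = \<bar>int x - int y\<bar>"
  shows "\<alpha> \<in> partial_cofinite_isometries"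
  using assms unfolding partial_cofinite_isometries_def by (auto simp: dom_def)

lemma partial_cofinite_isometriesD:
  assumes "\<alpha> \<in> partial_cofinite_isometries"
  shows "dom \<alpha> \<subseteq> pos_nats" "ran \<alpha> \<subseteq> pos_nats"
    "finite (pos_nats - dom \<alpha>)" "finite (pos_nats - ran \<alpha>)"
    "\<alpha> x = Some u \<Longrightarrow> \<alpha> y = Some v \<Longrightarrow> \<bar>int u - int v\<bar> = \<bar>int x - int y\<bar>"
proof -
  show "\<bar>int u - int v\<bar> = \<bar>int x - int y\<bar>" if "\<alpha> x = Some u" "\<alpha> y = Some v"
  proof -
    have "x \<in> dom \<alpha>" "y \<in> dom \<alpha>"
      using that by auto
    then have "\<bar>int (the (\<alpha> x)) - int (the (\<alpha> y))\<bar> = \<bar>int x - int y\<bar>"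
      using assms unfolding partial_cofinite_isometries_def by blast
    then show ?thesis
      using that by simp
  qed
qed (use assms in \<open>auto simp: partial_cofinite_isometries_def\<close>)

lemma eventually_defined:
  assumes "\<alpha> \<in> partial_cofinite_isometries"
  obtains N where "\<And>x. N \<le> x \<Longrightarrow> x \<in> dom \<alpha>"
proof -
  obtain M where M: "\<forall>x\<in>pos_nats - dom \<alpha>. x < M"
    using partial_cofinite_isometriesD(3)[OF assms] finite_nat_set_iff_bounded by blast
  show thesis
  proof (rule that[of "Suc M"])
    show "x \<in> dom \<alpha>" if "Suc M \<le> x" for x
    proof (rule ccontr)
      assume "x \<notin> dom \<alpha>"
      with that have "x \<in> pos_nats - dom \<alpha>" by simp
      with M have "x < M" by blast
      with that show False by simp
    qed
  qed
qed

section \<open>The monoid is closed under composition\<close>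

text \<open>
  The points that a composite misses come from the points that its factors miss: in the domain,
  as preimages under the first factor, which is injective; in the range, as images under the
  second.
\<close>

lemma comp_closed:
  assumes "\<alpha> \<in> partial_cofinite_isometries" and "\<beta> \<in> partial_cofinite_isometries"
  shows "\<beta> \<circ>\<^sub>m \<alpha> \<in> partial_cofinite_isometries"
proof (rule partial_cofinite_isometriesI)
  note A = partial_cofinite_isometriesD[OF assms(1)]
  note B = partial_cofinite_isometriesD[OF assms(2)]
  show "dom (\<beta> \<circ>\<^sub>m \<alpha>) \<subseteq> pos_nats"
    using A(1) by (auto simp: map_comp_Some_iff dom_def)
  show "ran (\<beta> \<circ>\<^sub>m \<alpha>) \<subseteq> pos_nats"
    using B(2) by (auto simp: map_comp_Some_iff ran_def)
  have "inj_on (\<lambda>x. the (\<alpha> x)) (dom \<alpha>)"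
    by (rule inj_onI) (use A(5) in fastforce)
  then have "finite ((\<lambda>x. the (\<alpha> x)) -` (pos_nats - dom \<beta>) \<inter> dom \<alpha>)"
    using B(3) by (rule finite_vimage_IntI[rotated])
  moreover have "pos_nats - dom (\<beta> \<circ>\<^sub>m \<alpha>) \<subseteq>
      (pos_nats - dom \<alpha>) \<union> ((\<lambda>x. the (\<alpha> x)) -` (pos_nats - dom \<beta>) \<inter> dom \<alpha>)"
  proof
    fix x assume x: "x \<in> pos_nats - dom (\<beta> \<circ>\<^sub>m \<alpha>)"
    show "x \<in> (pos_nats - dom \<alpha>) \<union> ((\<lambda>x. the (\<alpha> x)) -` (pos_nats - dom \<beta>) \<inter> dom \<alpha>)"
    proof (cases "\<alpha> x")
      case None
      then show ?thesis using x by auto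
    next
      case (Some y)
      then have "y \<in> pos_nats" using A(2) ranI by fast
      then show ?thesis using x Some by (auto simp: domIff)
    qed
  qed
  ultimately show "finite (pos_nats - dom (\<beta> \<circ>\<^sub>m \<alpha>))"
    using A(3) by (meson finite_UnI finite_subset)
  have "pos_nats - ran (\<beta> \<circ>\<^sub>m \<alpha>) \<subseteq>
      (pos_nats - ran \<beta>) \<union> (\<lambda>y. the (\<beta> y)) ` (pos_nats - ran \<alpha>)"
  proof
    fix z assume z: "z \<in> pos_nats - ran (\<beta> \<circ>\<^sub>m \<alpha>)"
    show "z \<in> (pos_nats - ran \<beta>) \<union> (\<lambda>y. the (\<beta> y)) ` (pos_nats - ran \<alpha>)"
    proof (cases "z \<in> ran \<beta>")
      case True
      then obtain y where y: "\<beta> y = Some z" by (auto simp: ran_def)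
      then have "y \<in> pos_nats" using B(1) by blast
      moreover have "y \<notin> ran \<alpha>"
      proof
        assume "y \<in> ran \<alpha>"
        then obtain x where "\<alpha> x = Some y" by (auto simp: ran_def)
        with y have "(\<beta> \<circ>\<^sub>m \<alpha>) x = Some z" by simp
        with z show False by (auto simp: ran_def)
      qed
      ultimately show ?thesis using y by (intro UnI2 image_eqI[of _ _ y]) auto
    qed (use z in auto)
  qed
  then show "finite (pos_nats - ran (\<beta> \<circ>\<^sub>m \<alpha>))"
    using A(4) B(4) by (meson finite_UnI finite_imageI finite_subset)
  show "\<bar>int u - int v\<bar> = \<bar>int x - int y\<bar>"
    if "(\<beta> \<circ>\<^sub>m \<alpha>) x = Some u" "(\<beta> \<circ>\<^sub>m \<alpha>) y = Some v" for x y u v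
    using that A(5) B(5) by (fastforce simp: map_comp_Some_iff)
qed

lemma map_comp_assoc: "\<gamma> \<circ>\<^sub>m (\<beta> \<circ>\<^sub>m \<alpha>) = (\<gamma> \<circ>\<^sub>m \<beta>) \<circ>\<^sub>m \<alpha>"
  by (rule ext) (simp add: map_comp_def split: option.split)

section \<open>Cofinite isometries are translations\<close>

text \<open>
  Compare both points with a third one so far to the right that its image cannot lie to the left
  of theirs.
\<close>

lemma isometry_is_translation:
  assumes "\<alpha> \<in> partial_cofinite_isometries" and "\<alpha> x = Some u" and "\<alpha> y = Some v"
  shows "int u - int x = int v - int y"
proof -
  obtain N where N: "\<And>z. N \<le> z \<Longrightarrow> z \<in> dom \<alpha>"
    using eventually_defined[OF assms(1)] by blast
  define z where "z = N + x + y + u + v"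
  obtain w where w: "\<alpha> z = Some w"
    using N[of z] by (auto simp: z_def)
  have "\<bar>int w - int u\<bar> = \<bar>int z - int x\<bar>" "\<bar>int w - int v\<bar> = \<bar>int z - int y\<bar>"
    using partial_cofinite_isometriesD(5)[OF assms(1) w] assms(2,3) by blast+
  then show ?thesis
    unfolding z_def by linarith
qed

section \<open>Shifts and simplicity\<close>

definition shift_up :: "nat \<Rightarrow> nat \<rightharpoonup> nat" where
  "shift_up m x = (if 1 \<le> x then Some (x + m) else None)"

definition shift_down :: "nat \<Rightarrow> nat \<rightharpoonup> nat" where
  "shift_down m x = (if m < x then Some (x - m) else None)"

lemma shift_up_closed: "shift_up m \<in> partial_cofinite_isometries"
proof (rule partial_cofinite_isometriesI)
  have "dom (shift_up m) = pos_nats"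
    by (auto simp: shift_up_def dom_def)
  then show "dom (shift_up m) \<subseteq> pos_nats" "finite (pos_nats - dom (shift_up m))"
    by auto
  have "y \<in> ran (shift_up m)" if "m < y" for y
    using that by (intro ranI[of _ "y - m"]) (simp add: shift_up_def)
  then have "pos_nats - ran (shift_up m) \<subseteq> {..m}"
    by (auto simp flip: not_less)
  then show "finite (pos_nats - ran (shift_up m))"
    by (rule finite_subset) simp
qed (auto simp: shift_up_def ran_def split: if_splits)

lemma shift_down_closed: "shift_down m \<in> partial_cofinite_isometries"
proof (rule partial_cofinite_isometriesI)
  have "pos_nats - dom (shift_down m) \<subseteq> {..m}"
    by (auto simp: shift_down_def dom_def)
  then show "finite (pos_nats - dom (shift_down m))"
    by (rule finite_subset) simp
  have "y \<in> ran (shift_down m)" if "1 \<le> y" for y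
    using that by (intro ranI[of _ "y + m"]) (simp add: shift_down_def)
  then have "pos_nats - ran (shift_down m) = {}"
    by auto
  then show "finite (pos_nats - ran (shift_down m))"
    by (metis finite.emptyI)
qed (auto simp: shift_down_def ran_def split: if_splits)

text \<open>
  If \<open>\<alpha>\<close> is defined from \<open>N\<close> onwards, then \<open>N + x\<close> is sent to \<open>m + x\<close>, where \<open>m\<close> is the image of
  \<open>N\<close>.  Shifting up by \<open>N\<close> before \<open>\<alpha>\<close> and down by \<open>m\<close> after it thus cancels exactly.
\<close>

lemma two_sided_divisor_of_one:
  assumes "\<alpha> \<in> partial_cofinite_isometries"
  obtains N m where "shift_down m \<circ>\<^sub>m (\<alpha> \<circ>\<^sub>m shift_up N) = Some |` pos_nats"
proof -
  obtain N where N: "\<And>x. N \<le> x \<Longrightarrow> x \<in> dom \<alpha>"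
    using eventually_defined[OF assms] by blast
  obtain m where m: "\<alpha> N = Some m"
    using N[of N] by auto
  have shifted: "\<alpha> (x + N) = Some (x + m)" for x
  proof -
    obtain w where w: "\<alpha> (x + N) = Some w"
      using N[of "x + N"] by auto
    have "w = x + m"
      using isometry_is_translation[OF assms w m] by simp
    then show ?thesis
      using w by simp
  qed
  have "shift_down m \<circ>\<^sub>m (\<alpha> \<circ>\<^sub>m shift_up N) = Some |` pos_nats"
    by (rule ext) (simp add: map_comp_def shift_up_def shift_down_def shifted restrict_map_def)
  then show thesis
    by (rule that)
qed

theorem mainTheorem2:
  shows "simple_semigroup IN_infinity"
proof
  show "x \<otimes>\<^bsub>IN_infinity\<^esub> y \<in> carrier IN_infinity"
    if "x \<in> carrier IN_infinity" "y \<in> carrier IN_infinity" for x y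
    using that by (simp add: IN_infinity_def comp_closed)
  show "(x \<otimes>\<^bsub>IN_infinity\<^esub> y) \<otimes>\<^bsub>IN_infinity\<^esub> z = x \<otimes>\<^bsub>IN_infinity\<^esub> (y \<otimes>\<^bsub>IN_infinity\<^esub> z)" for x y z
    by (simp add: IN_infinity_def map_comp_assoc)
next
  fix I assume "two_sided_ideal I IN_infinity"
  then have sub: "I \<subseteq> partial_cofinite_isometries" and "I \<noteq> {}"
    and absorb: "\<And>\<alpha> \<sigma>. \<alpha> \<in> I \<Longrightarrow> \<sigma> \<in> partial_cofinite_isometries \<Longrightarrow> \<alpha> \<circ>\<^sub>m \<sigma> \<in> I \<and> \<sigma> \<circ>\<^sub>m \<alpha> \<in> I"
    by (auto simp: two_sided_ideal_def IN_infinity_def)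
  then obtain \<alpha> where "\<alpha> \<in> I" and "\<alpha> \<in> partial_cofinite_isometries"
    by blast
  moreover obtain N m where "shift_down m \<circ>\<^sub>m (\<alpha> \<circ>\<^sub>m shift_up N) = Some |` pos_nats"
    using two_sided_divisor_of_one[OF \<open>\<alpha> \<in> partial_cofinite_isometries\<close>] .
  ultimately have one: "Some |` pos_nats \<in> I"
    using absorb shift_up_closed shift_down_closed by metis
  have "\<beta> \<in> I" if "\<beta> \<in> partial_cofinite_isometries" for \<beta>
  proof -
    have "0 \<notin> dom \<beta>"
      using partial_cofinite_isometriesD(1)[OF that] by auto
    then have "\<beta> \<circ>\<^sub>m (Some |` pos_nats) = \<beta>"
      by (intro ext) (auto simp: map_comp_def restrict_map_def domIff not_le)
    then show ?thesis
      using absorb[OF one that] by simp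
  qed
  with sub show "I = carrier IN_infinity"
    by (auto simp: IN_infinity_def)
qed

end
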